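(* Let $A$ be a normal $n\times n$ complex matrix, i.e. $AA^*=A^*A$. Let $\|A\|_E$ be its Euclidean norm and $\|A\|$ its norm with respect to any other norm on $\mathbb{C}^n$. Then $$\|A\|_E\le\|A\|.$$
   Context: $\|A\|_E=\lambda_*^{1/2}$, where $\lambda_*$ is the largest eigenvalue of $A^*A$ (the operator norm induced by the Euclidean vector norm). $\|A\|$ is the operator norm induced by an arbitrary vector norm on $\mathbb{C}^n$. *)

theory Defs
  imports Complex_Main "Jordan_Normal_Form.Char_Poly" "Jordan_Normal_Form.Schur_Decomposition"
begin

definition is_vec_norm :: "nat \<Rightarrow> (complex vec \<Rightarrow> real) \<Rightarrow> bool" where
  "is_vec_norm n N \<longleftrightarrow>
     (\<forall>v \<in> carrier_vec n. 0 \<le> N v) \<and>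
     (\<forall>v \<in> carrier_vec n. N v = 0 \<longleftrightarrow> v = 0\<^sub>v n) \<and>
     (\<forall>c. \<forall>v \<in> carrier_vec n. N (c \<cdot>\<^sub>v v) = cmod c * N v) \<and>
     (\<forall>v \<in> carrier_vec n. \<forall>w \<in> carrier_vec n. N (v + w) \<le> N v + N w)"

(* The supremum is over a nonempty bounded set whenever n > 0, N is a norm on C^n
   and A is an n x n matrix. *)
definition operator_norm :: "nat \<Rightarrow> (complex vec \<Rightarrow> real) \<Rightarrow> complex mat \<Rightarrow> real" where
  "operator_norm n N A = (SUP v \<in> carrier_vec n - {0\<^sub>v n}. N (A *\<^sub>v v) / N v)"

(* mat_adjoint is the conjugate transpose.  All eigenvalues of A^* A are real (and nonnegative),
   so the maximum over its real eigenvalues is the maximum over all of them; the set is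
   finite and, for matrices of dimension at least 1, nonempty. *)
definition euclidean_norm :: "complex mat \<Rightarrow> real" where
  "euclidean_norm A = sqrt (Max {r. eigenvalue (mat_adjoint A * A) (complex_of_real r)})"

end

theory Submission
  imports "HOL-Analysis.Function_Topology" "HOL-Analysis.Topology_Euclidean_Space"
    "Jordan_Normal_Form.Spectral_Radius" Defs
begin

text \<open>
  Let \<open>r\<close> be an eigenvalue of \<open>A\<^sup>* A\<close> with eigenvector \<open>x\<close>; the task is to bound
  \<open>sqrt r\<close> by the operator norm \<open>\<parallel>A\<parallel>\<close> that a given vector norm \<open>N\<close> induces. Writing \<open>|v|\<close> for
  Euclidean length, \<open>|A x|\<^sup>2 = \<langle>A\<^sup>* A x, x\<rangle> = r |x|\<^sup>2\<close>. A normal \<open>A\<close> commutes with \<open>A\<^sup>* A\<close>,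
  so \<open>A x\<close>, \<open>A\<^sup>2 x\<close>, \<open>\<dots>\<close> are again in the \<open>r\<close>-eigenspace of \<open>A\<^sup>* A\<close>, and each application of
  \<open>A\<close> stretches by exactly \<open>sqrt r\<close>: the length of the \<open>k\<close>-th iterate is \<open>(sqrt r)^k |x|\<close>
  (\<open>length_power_mult_eigenvector\<close>). Measured by \<open>N\<close> instead, the \<open>k\<close>-th iterate
  is at most \<open>\<parallel>A\<parallel>^k N x\<close>.

  Any two norms on \<open>\<complex>\<^sup>n\<close> are equivalent, so the two measurements of an iterate differ by at
  most a factor that does not depend on \<open>k\<close>. Hence \<open>c |x| (sqrt r)^k \<le> N x \<parallel>A\<parallel>^k\<close> for all \<open>k\<close>,
  and comparing growth rates gives \<open>sqrt r \<le> \<parallel>A\<parallel>\<close>.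

  Equivalence of norms (\<open>seminorm_le_euclidean_length\<close>, \<open>euclidean_length_le_vec_norm\<close>)
  is used a second time: it makes the supremum defining \<open>\<parallel>A\<parallel>\<close> a supremum of a bounded set,
  without which it would not bound the quotients \<open>N (A v) / N v\<close>.
\<close>

(* Throughout, $ and \<bullet> are the entries and the scalar product of vectors whose dimension is a
   number, not a type. *)
unbundle no vec_syntax and no inner_syntax

section \<open>Equivalence of vector norms with Euclidean length\<close>

definition euclidean_length :: "complex vec \<Rightarrow> real" where
  "euclidean_length v = L2_set (\<lambda>i. cmod (v $ i)) {..<dim_vec v}"

lemma euclidean_length_nonneg: "0 \<le> euclidean_length v"
  by (simp add: euclidean_length_def L2_set_nonneg)

lemma norm_coord_le_euclidean_length:
  assumes "i < dim_vec v"
  shows "cmod (v $ i) \<le> euclidean_length v"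
  unfolding euclidean_length_def by (rule member_le_L2_set) (use assms in auto)

lemma euclidean_length_pos:
  assumes "v \<in> carrier_vec n" and "v \<noteq> 0\<^sub>v n"
  shows "0 < euclidean_length v"
proof -
  obtain i where "i < dim_vec v" "v $ i \<noteq> 0"
    using assms by (metis carrier_vecD eq_vecI index_zero_vec(1) index_zero_vec(2))
  then show ?thesis
    using norm_coord_le_euclidean_length[of i v] by (smt (verit) zero_less_norm_iff)
qed

lemma euclidean_length_smult: "euclidean_length (c \<cdot>\<^sub>v v) = cmod c * euclidean_length v"
proof -
  have "L2_set (\<lambda>i. cmod ((c \<cdot>\<^sub>v v) $ i)) {..<dim_vec v} =
        L2_set (\<lambda>i. cmod c * cmod (v $ i)) {..<dim_vec v}"
    by (rule L2_set_cong) (auto simp: norm_mult)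
  then show ?thesis
    by (simp add: euclidean_length_def L2_set_right_distrib)
qed

lemma euclidean_length_zero: "euclidean_length (0\<^sub>v n) = 0"
  by (simp add: euclidean_length_def L2_set_def)

text \<open>
  This is the triangle inequality for the expansion of \<open>v\<close> in the standard basis. It is stated
  for seminorms because it is applied both to a norm \<open>N\<close> and to \<open>\<lambda>v. N (A *\<^sub>v v)\<close>, which vanishes
  on the kernel of \<open>A\<close>.
\<close>

lemma seminorm_le_sum_coords:
  fixes f :: "complex vec \<Rightarrow> real"
  assumes smult: "\<And>c v. v \<in> carrier_vec n \<Longrightarrow> f (c \<cdot>\<^sub>v v) = cmod c * f v"
    and triangle: "\<And>v w. v \<in> carrier_vec n \<Longrightarrow> w \<in> carrier_vec n \<Longrightarrow> f (v + w) \<le> f v + f w"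
    and v: "v \<in> carrier_vec n"
  shows "f v \<le> (\<Sum>i<n. cmod (v $ i) * f (unit_vec n i))"
proof -
  (* Truncations build v up one basis vector at a time. *)
  define trunc where "trunc k = vec n (\<lambda>i. if i < k then v $ i else 0)" for k
  have "f (trunc k) \<le> (\<Sum>i<k. cmod (v $ i) * f (unit_vec n i))" if "k \<le> n" for k
    using that
  proof (induction k)
    case 0
    have "trunc 0 = 0 \<cdot>\<^sub>v 0\<^sub>v n" unfolding trunc_def by (intro eq_vecI) auto
    then show ?case by (simp only: smult zero_carrier_vec) simp
  next
    case (Suc k)
    have "trunc (Suc k) = trunc k + (v $ k) \<cdot>\<^sub>v unit_vec n k"
      unfolding trunc_def using Suc.prems
      by (intro eq_vecI) (auto simp: less_Suc_eq unit_vec_def)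
    moreover have "trunc k \<in> carrier_vec n" by (simp add: trunc_def)
    ultimately have "f (trunc (Suc k)) \<le> f (trunc k) + cmod (v $ k) * f (unit_vec n k)"
      using triangle[of "trunc k" "(v $ k) \<cdot>\<^sub>v unit_vec n k"] smult[of "unit_vec n k" "v $ k"]
      by simp
    with Suc show ?case by simp
  qed
  from this[of n] moreover have "trunc n = v"
    unfolding trunc_def using v by (intro eq_vecI) auto
  ultimately show ?thesis by simp
qed

lemma seminorm_le_euclidean_length:
  fixes f :: "complex vec \<Rightarrow> real"
  assumes smult: "\<And>c v. v \<in> carrier_vec n \<Longrightarrow> f (c \<cdot>\<^sub>v v) = cmod c * f v"
    and triangle: "\<And>v w. v \<in> carrier_vec n \<Longrightarrow> w \<in> carrier_vec n \<Longrightarrow> f (v + w) \<le> f v + f w"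
    and nonneg: "\<And>v. v \<in> carrier_vec n \<Longrightarrow> 0 \<le> f v"
  obtains M where "0 \<le> M" "\<And>v. v \<in> carrier_vec n \<Longrightarrow> f v \<le> M * euclidean_length v"
proof
  let ?M = "\<Sum>i<n. f (unit_vec n i)"
  show "0 \<le> ?M" by (intro sum_nonneg nonneg) simp
  fix v :: "complex vec" assume v: "v \<in> carrier_vec n"
  have "f v \<le> (\<Sum>i<n. cmod (v $ i) * f (unit_vec n i))"
    by (rule seminorm_le_sum_coords[OF smult triangle v])
  also have "\<dots> \<le> (\<Sum>i<n. euclidean_length v * f (unit_vec n i))"
    using v by (intro sum_mono mult_right_mono norm_coord_le_euclidean_length nonneg) auto
  also have "\<dots> = ?M * euclidean_length v"
    by (simp add: sum_distrib_left mult.commute)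
  finally show "f v \<le> ?M * euclidean_length v" .
qed

lemma is_vec_normD:
  assumes "is_vec_norm n N" and "v \<in> carrier_vec n"
  shows "0 \<le> N v" "N v = 0 \<longleftrightarrow> v = 0\<^sub>v n" "N (c \<cdot>\<^sub>v v) = cmod c * N v"
    "w \<in> carrier_vec n \<Longrightarrow> N (v + w) \<le> N v + N w"
  using assms unfolding is_vec_norm_def by blast+

lemma vec_norm_pos:
  assumes "is_vec_norm n N" "v \<in> carrier_vec n" "v \<noteq> 0\<^sub>v n"
  shows "0 < N v"
  using is_vec_normD(1,2)[OF assms(1,2)] assms(3) by fastforce

lemma vec_norm_diff_le:
  assumes N: "is_vec_norm n N" and x: "x \<in> carrier_vec n" and y: "y \<in> carrier_vec n"
  shows "\<bar>N x - N y\<bar> \<le> (\<Sum>i<n. cmod (x $ i - y $ i) * N (unit_vec n i))"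
proof -
  have *: "N a - N b \<le> (\<Sum>i<n. cmod (a $ i - b $ i) * N (unit_vec n i))"
    if a: "a \<in> carrier_vec n" and b: "b \<in> carrier_vec n" for a b
  proof -
    have "a = (a - b) + b" using a b by (intro eq_vecI) auto
    then have "N a \<le> N (a - b) + N b"
      using is_vec_normD(4)[OF N, of "a - b" b] a b by fastforce
    moreover have "N (a - b) \<le> (\<Sum>i<n. cmod ((a - b) $ i) * N (unit_vec n i))"
      using a b by (intro seminorm_le_sum_coords is_vec_normD[OF N]) auto
    ultimately show ?thesis using a b by simp
  qed
  show ?thesis
    using *[OF x y] *[OF y x] by (simp add: abs_le_iff norm_minus_commute)
qed

text \<open>
  Vectors whose dimension is a number rather than a type form no topological space, but functions
  \<open>nat \<Rightarrow> complex\<close> do, with the product topology. So \<open>N\<close> is pulled back along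
  \<open>x \<mapsto> vec n x\<close>, which reads only the first \<open>n\<close> coordinates; each coordinate is continuous, and
  \<open>N\<close> is Lipschitz in them.
\<close>

lemma continuous_vec_norm:
  assumes N: "is_vec_norm n N"
  shows "continuous_on UNIV (\<lambda>x. N (vec n x))"
  unfolding continuous_on_def
proof
  fix x :: "nat \<Rightarrow> complex"
  let ?g = "\<lambda>y. \<Sum>i<n. cmod (y i - x i) * N (unit_vec n i)"
  have coord: "continuous_on UNIV (\<lambda>y :: nat \<Rightarrow> complex. y i)" for i
    by (rule continuous_on_product_coordinates)
  have "continuous_on UNIV ?g"
    by (intro continuous_on_sum continuous_on_mult continuous_on_norm continuous_on_diff
        continuous_on_const coord)
  then have "(?g \<longlongrightarrow> ?g x) (at x)"
    unfolding continuous_on_def by (rule bspec) simp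
  then have "(?g \<longlongrightarrow> 0) (at x)" by simp
  have "norm (N (vec n y) - N (vec n x)) \<le> ?g y" for y
    using vec_norm_diff_le[OF N, of "vec n y" "vec n x"] by simp
  then have "\<forall>\<^sub>F y in at x. norm (N (vec n y) - N (vec n x)) \<le> ?g y"
    by (simp add: always_eventually)
  then have "((\<lambda>y. N (vec n y) - N (vec n x)) \<longlongrightarrow> 0) (at x)"
    using \<open>(?g \<longlongrightarrow> 0) (at x)\<close> by (rule Lim_null_comparison)
  then show "((\<lambda>x. N (vec n x)) \<longlongrightarrow> N (vec n x)) (at x)"
    by (rule LIM_zero_cancel)
qed

text \<open>
  Setting the coordinates from \<open>n\<close> on to \<open>0\<close> puts the sphere into a product of compact sets, to
  which Tychonoff's theorem applies.
\<close>

lemma compact_unit_sphere: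
  "compact {x :: nat \<Rightarrow> complex. (\<forall>i\<ge>n. x i = 0) \<and> L2_set (\<lambda>i. cmod (x i)) {..<n} = 1}"
    (is "compact ?S")
proof -
  let ?K = "\<lambda>i. if i < n then cball 0 1 else {0 :: complex}"
  have coord: "continuous_on UNIV (\<lambda>x :: nat \<Rightarrow> complex. x i)" for i
    by (rule continuous_on_product_coordinates)
  have "compactin (product_topology (\<lambda>i. euclidean) UNIV) (Pi\<^sub>E UNIV ?K)"
    unfolding compactin_PiE by simp
  then have "compact (Pi\<^sub>E UNIV ?K)"
    by (simp add: euclidean_product_topology compactin_euclidean_iff)
  moreover have "closed {x :: nat \<Rightarrow> complex. L2_set (\<lambda>i. cmod (x i)) {..<n} = 1}"
    unfolding L2_set_def
    by (intro closed_Collect_eq continuous_on_real_sqrt continuous_on_sum continuous_on_power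
        continuous_on_norm continuous_on_const coord)
  moreover have "?S = Pi\<^sub>E UNIV ?K \<inter> {x. L2_set (\<lambda>i. cmod (x i)) {..<n} = 1}"
    (is "_ = ?R")
  proof
    show "?S \<subseteq> ?R"
    proof
      fix x assume x: "x \<in> ?S"
      then have "cmod (x i) \<le> 1" if "i < n" for i
        using member_le_L2_set[of "{..<n}" i "\<lambda>i. cmod (x i)"] that by auto
      with x show "x \<in> ?R" by (auto simp: PiE_UNIV_domain)
    qed
    show "?R \<subseteq> ?S" by (fastforce simp: PiE_UNIV_domain Pi_iff split: if_splits)
  qed
  ultimately show ?thesis by (simp add: compact_Int_closed)
qed

text \<open>
  The constant is the minimum of \<open>N\<close> on the Euclidean unit sphere. It is attained, by
  compactness, at a nonzero vector, and so it is positive.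
\<close>

lemma euclidean_length_le_vec_norm:
  assumes n: "n > 0" and N: "is_vec_norm n N"
  obtains c where "0 < c" "\<And>v. v \<in> carrier_vec n \<Longrightarrow> c * euclidean_length v \<le> N v"
proof -
  let ?S = "{x :: nat \<Rightarrow> complex. (\<forall>i\<ge>n. x i = 0) \<and> L2_set (\<lambda>i. cmod (x i)) {..<n} = 1}"
  (* The first unit vector witnesses that the sphere is nonempty. *)
  have "L2_set (\<lambda>i. cmod (if i = (0::nat) then 1 else 0)) {..<n} = 1"
  proof -
    have "(\<Sum>i<n. (cmod (if i = 0 then 1 else 0))\<^sup>2) = (\<Sum>i<n. if i = 0 then 1 else 0 :: real)"
      by (rule sum.cong) auto
    with n show ?thesis by (simp add: L2_set_def)
  qed
  then have "(\<lambda>i. if i = 0 then 1 else 0) \<in> ?S" using n by auto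
  then have nonempty: "?S \<noteq> {}" by (metis empty_iff)
  have cont: "continuous_on ?S (\<lambda>x. N (vec n x))"
    by (rule continuous_on_subset[OF continuous_vec_norm[OF N] subset_UNIV])
  have "\<exists>x\<in>?S. \<forall>y\<in>?S. N (vec n x) \<le> N (vec n y)"
    by (rule continuous_attains_inf[OF compact_unit_sphere nonempty cont])
  then obtain x where x: "x \<in> ?S" and min: "\<forall>y\<in>?S. N (vec n x) \<le> N (vec n y)"
    by (elim bexE)
  have len: "euclidean_length (vec n y) = L2_set (\<lambda>i. cmod (y i)) {..<n}" for y
    unfolding euclidean_length_def by (rule L2_set_cong) auto
  show thesis
  proof
    have "euclidean_length (vec n x) = 1" using x by (simp add: len)
    then have "vec n x \<noteq> 0\<^sub>v n" by (metis euclidean_length_zero zero_neq_one)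
    then show "0 < N (vec n x)" using vec_norm_pos[OF N] by simp
  next
    fix v :: "complex vec" assume v: "v \<in> carrier_vec n"
    show "N (vec n x) * euclidean_length v \<le> N v"
    proof (cases "v = 0\<^sub>v n")
      case True
      then show ?thesis using is_vec_normD(1)[OF N v] by (simp add: euclidean_length_zero)
    next
      case False
      define u where "u = complex_of_real (1 / euclidean_length v) \<cdot>\<^sub>v v"
      have pos: "0 < euclidean_length v" by (rule euclidean_length_pos[OF v False])
      have u: "u \<in> carrier_vec n" using v by (simp add: u_def)
      have "euclidean_length u = 1"
        unfolding u_def euclidean_length_smult using pos by (simp add: norm_divide)
      define y where "y i = (if i < n then u $ i else 0)" for i
      have y: "vec n y = u" using u by (intro eq_vecI) (auto simp: y_def)
      have "y \<in> ?S"
        using \<open>euclidean_length u = 1\<close> len[of y] unfolding y by (simp add: y_def)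
      then have "N (vec n x) \<le> N u" using min y by auto
      also have "\<dots> = N v / euclidean_length v"
        unfolding u_def is_vec_normD(3)[OF N v] using pos by (simp add: norm_divide)
      finally show ?thesis using pos by (simp add: field_simps)
    qed
  qed
qed

section \<open>The operator norm\<close>

text \<open>
  The seminorm \<open>\<lambda>v. N (A *\<^sub>v v)\<close> is bounded by a multiple of Euclidean length, which in turn is
  bounded by a multiple of \<open>N\<close>.
\<close>

lemma bdd_above_operator_norm:
  assumes n: "n > 0" and A: "A \<in> carrier_mat n n" and N: "is_vec_norm n N"
  shows "bdd_above ((\<lambda>v. N (A *\<^sub>v v) / N v) ` (carrier_vec n - {0\<^sub>v n}))"
proof -
  obtain c where c: "0 < c" "\<And>v. v \<in> carrier_vec n \<Longrightarrow> c * euclidean_length v \<le> N v"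
    using euclidean_length_le_vec_norm[OF n N] by blast
  have smult: "N (A *\<^sub>v (k \<cdot>\<^sub>v v)) = cmod k * N (A *\<^sub>v v)" if "v \<in> carrier_vec n" for k v
    using A that by (simp add: mult_mat_vec[OF A that] is_vec_normD(3)[OF N])
  have triangle: "N (A *\<^sub>v (v + w)) \<le> N (A *\<^sub>v v) + N (A *\<^sub>v w)"
    if "v \<in> carrier_vec n" "w \<in> carrier_vec n" for v w
    using A that by (simp add: mult_add_distrib_mat_vec[OF A that] is_vec_normD(4)[OF N])
  have nonneg: "0 \<le> N (A *\<^sub>v v)" if "v \<in> carrier_vec n" for v
    using A that by (simp add: is_vec_normD(1)[OF N])
  obtain M where M: "0 \<le> M"
    "\<And>v. v \<in> carrier_vec n \<Longrightarrow> N (A *\<^sub>v v) \<le> M * euclidean_length v"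
    using seminorm_le_euclidean_length[of n "\<lambda>v. N (A *\<^sub>v v)", OF smult triangle nonneg]
    by blast
  show ?thesis
  proof (rule bdd_aboveI2)
    fix v :: "complex vec" assume "v \<in> carrier_vec n - {0\<^sub>v n}"
    then have v: "v \<in> carrier_vec n" and pos: "0 < N v" using vec_norm_pos[OF N] by auto
    have "N (A *\<^sub>v v) \<le> M * euclidean_length v" by (rule M(2)[OF v])
    also have "\<dots> \<le> M * (N v / c)"
      using c(2)[OF v] c(1) by (intro mult_left_mono M(1)) (simp add: field_simps)
    finally have "N (A *\<^sub>v v) \<le> M * (N v / c)" .
    then show "N (A *\<^sub>v v) / N v \<le> M / c" using pos c(1) by (simp add: field_simps)
  qed
qed

lemma vec_norm_mult_le_operator_norm:
  assumes n: "n > 0" and A: "A \<in> carrier_mat n n" and N: "is_vec_norm n N"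
    and v: "v \<in> carrier_vec n"
  shows "N (A *\<^sub>v v) \<le> operator_norm n N A * N v"
proof (cases "v = 0\<^sub>v n")
  case True
  have "A *\<^sub>v v = 0\<^sub>v n" using A True by (intro eq_vecI) auto
  then show ?thesis using True is_vec_normD(2)[OF N, of "0\<^sub>v n"] by simp
next
  case False
  have "N (A *\<^sub>v v) / N v \<le> operator_norm n N A"
    unfolding operator_norm_def
    by (rule cSUP_upper[OF _ bdd_above_operator_norm[OF n A N]]) (use v False in simp)
  then show ?thesis using vec_norm_pos[OF N v False] by (simp add: field_simps)
qed

lemma operator_norm_nonneg:
  assumes n: "n > 0" and A: "A \<in> carrier_mat n n" and N: "is_vec_norm n N"
  shows "0 \<le> operator_norm n N A"
proof -
  have e: "unit_vec n 0 \<in> carrier_vec n" "unit_vec n 0 \<noteq> (0\<^sub>v n :: complex vec)"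
    using n by auto
  have "0 \<le> N (A *\<^sub>v unit_vec n 0)" using A is_vec_normD(1)[OF N] by simp
  also have "\<dots> \<le> operator_norm n N A * N (unit_vec n 0)"
    by (rule vec_norm_mult_le_operator_norm[OF n A N e(1)])
  finally show ?thesis using vec_norm_pos[OF N e] by (simp add: zero_le_mult_iff)
qed

section \<open>Eigenvectors of the adjoint times the matrix\<close>

lemma mat_adjoint_carrier: "A \<in> carrier_mat n m \<Longrightarrow> mat_adjoint A \<in> carrier_mat m n"
  unfolding mat_adjoint_def by auto

lemma mat_adjoint_cscalar_prod:
  assumes A: "A \<in> carrier_mat n m" and x: "x \<in> carrier_vec m" and y: "y \<in> carrier_vec n"
  shows "(mat_adjoint A *\<^sub>v y) \<bullet>c x = y \<bullet>c (A *\<^sub>v x)"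
proof -
  have idx: "mat_adjoint A $$ (i, j) = conjugate (A $$ (j, i))" if "i < m" "j < n" for i j
    using A that unfolding mat_adjoint_def by (simp add: mat_of_rows_index)
  have "(mat_adjoint A *\<^sub>v y) \<bullet>c x =
      (\<Sum>i = 0..<m. (\<Sum>j = 0..<n. conjugate (A $$ (j, i)) * y $ j) * conjugate (x $ i))"
    using A x y mat_adjoint_carrier[OF A] by (simp add: scalar_prod_def idx)
  also have "\<dots> = (\<Sum>j = 0..<n. \<Sum>i = 0..<m. y $ j * (conjugate (A $$ (j, i)) * conjugate (x $ i)))"
    by (subst sum.swap) (simp add: sum_distrib_left sum_distrib_right mult_ac)
  also have "\<dots> = y \<bullet>c (A *\<^sub>v x)"
    using A x y by (simp add: scalar_prod_def sum_distrib_left sum_conjugate conjugate_dist_mul)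
  finally show ?thesis .
qed

lemma cscalar_prod_self: "v \<bullet>c v = complex_of_real ((euclidean_length v)\<^sup>2)"
proof -
  have "v \<bullet>c v = (\<Sum>i<dim_vec v. complex_of_real ((cmod (v $ i))\<^sup>2))"
    unfolding scalar_prod_def
    by (rule sum.cong) (auto simp: complex_norm_square[symmetric] simp del: of_real_power)
  also have "\<dots> = complex_of_real ((euclidean_length v)\<^sup>2)"
    by (simp add: euclidean_length_def L2_set_def sum_nonneg)
  finally show ?thesis .
qed

text \<open>
  Both sides equal \<open>\<langle>A\<^sup>* A x, x\<rangle>\<close>. The scalar is left complex so that the
  equation also shows that eigenvalues of \<open>A\<^sup>* A\<close> are real.
\<close>

lemma length_mult_eigenvector:
  assumes A: "A \<in> carrier_mat n n" and x: "x \<in> carrier_vec n"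
    and eig: "(mat_adjoint A * A) *\<^sub>v x = c \<cdot>\<^sub>v x"
  shows "complex_of_real ((euclidean_length (A *\<^sub>v x))\<^sup>2)
    = c * complex_of_real ((euclidean_length x)\<^sup>2)"
proof -
  have "complex_of_real ((euclidean_length (A *\<^sub>v x))\<^sup>2) = (mat_adjoint A *\<^sub>v (A *\<^sub>v x)) \<bullet>c x"
    using mat_adjoint_cscalar_prod[OF A x, of "A *\<^sub>v x"] A x
    by (simp add: cscalar_prod_self)
  also have "mat_adjoint A *\<^sub>v (A *\<^sub>v x) = c \<cdot>\<^sub>v x"
    using assoc_mult_mat_vec[OF mat_adjoint_carrier[OF A] A x] eig by simp
  also have "(c \<cdot>\<^sub>v x) \<bullet>c x = c * complex_of_real ((euclidean_length x)\<^sup>2)"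
    using x by (simp add: cscalar_prod_self)
  finally show ?thesis .
qed

lemma eigenvalue_adjoint_mult_real:
  assumes A: "A \<in> carrier_mat n n" and c: "eigenvalue (mat_adjoint A * A) c"
  shows "c = complex_of_real (Re c)"
proof -
  obtain x where x: "x \<in> carrier_vec n" "x \<noteq> 0\<^sub>v n" "(mat_adjoint A * A) *\<^sub>v x = c \<cdot>\<^sub>v x"
    using c mat_adjoint_carrier[OF A] unfolding eigenvalue_def eigenvector_def by auto
  have "0 < euclidean_length x" by (rule euclidean_length_pos[OF x(1,2)])
  then have "c = complex_of_real ((euclidean_length (A *\<^sub>v x))\<^sup>2 / (euclidean_length x)\<^sup>2)"
    using length_mult_eigenvector[OF A x(1,3)] by (simp add: field_simps)
  then show ?thesis by (metis Re_complex_of_real)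
qed

text \<open>
  This is where normality enters: \<open>A\<close> commutes with \<open>A\<^sup>* A\<close> and therefore maps the
  \<open>r\<close>-eigenspace of \<open>A\<^sup>* A\<close> to itself, so that \<open>length_mult_eigenvector\<close> applies to every
  iterate.
\<close>

lemma length_power_mult_eigenvector:
  assumes A: "A \<in> carrier_mat n n" and normal: "A * mat_adjoint A = mat_adjoint A * A"
    and x: "x \<in> carrier_vec n" and eig: "(mat_adjoint A * A) *\<^sub>v x = complex_of_real r \<cdot>\<^sub>v x"
  shows "euclidean_length (((*\<^sub>v) A ^^ k) x) = sqrt r ^ k * euclidean_length x"
proof -
  let ?B = "mat_adjoint A * A" and ?y = "\<lambda>k. ((*\<^sub>v) A ^^ k) x"
  note adj = mat_adjoint_carrier[OF A]
  have y: "?y k \<in> carrier_vec n" for k using A x by (induction k) auto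
  have eig_y: "?B *\<^sub>v ?y k = complex_of_real r \<cdot>\<^sub>v ?y k" for k
  proof (induction k)
    case 0
    show ?case using eig by simp
  next
    case (Suc k)
    have "?B *\<^sub>v (A *\<^sub>v ?y k) = A *\<^sub>v (?B *\<^sub>v ?y k)"
    proof -
      have Ay: "A *\<^sub>v ?y k \<in> carrier_vec n" using A y[of k] by simp
      have "?B *\<^sub>v (A *\<^sub>v ?y k) = (A * mat_adjoint A) *\<^sub>v (A *\<^sub>v ?y k)"
        using normal by simp
      also have "\<dots> = A *\<^sub>v (mat_adjoint A *\<^sub>v (A *\<^sub>v ?y k))"
        by (rule assoc_mult_mat_vec[OF A adj Ay])
      also have "mat_adjoint A *\<^sub>v (A *\<^sub>v ?y k) = ?B *\<^sub>v ?y k"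
        by (rule assoc_mult_mat_vec[OF adj A y, symmetric])
      finally show ?thesis .
    qed
    then show ?case
      by (simp add: Suc.IH mult_mat_vec[OF A y])
  qed
  have step: "euclidean_length (A *\<^sub>v ?y k) = sqrt r * euclidean_length (?y k)" for k
  proof -
    have "complex_of_real ((euclidean_length (A *\<^sub>v ?y k))\<^sup>2)
        = complex_of_real (r * (euclidean_length (?y k))\<^sup>2)"
      using length_mult_eigenvector[OF A y[of k] eig_y] by simp
    then have "(euclidean_length (A *\<^sub>v ?y k))\<^sup>2 = r * (euclidean_length (?y k))\<^sup>2"
      by (simp only: of_real_eq_iff)
    then have "sqrt ((euclidean_length (A *\<^sub>v ?y k))\<^sup>2) = sqrt (r * (euclidean_length (?y k))\<^sup>2)"
      by simp
    then show ?thesis by (simp add: real_sqrt_mult euclidean_length_nonneg)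
  qed
  show ?thesis by (induction k) (simp_all add: step)
qed

text \<open>
  If \<open>b < a\<close>, dividing by \<open>a ^ k\<close> would squeeze the positive number \<open>d\<close> below the null sequence
  \<open>C * (b / a) ^ k\<close>.
\<close>

lemma le_if_powers_le:
  fixes a b :: real
  assumes b: "0 \<le> b" and d: "0 < d" and le: "\<And>k. d * a ^ k \<le> C * b ^ k"
  shows "a \<le> b"
proof (rule ccontr)
  assume "\<not> a \<le> b"
  then have a: "0 < a" and q: "\<bar>b / a\<bar> < 1" using b by auto
  have "(\<lambda>k. C * (b / a) ^ k) \<longlonglongrightarrow> C * 0"
    by (intro tendsto_intros LIMSEQ_abs_realpow_zero2 q)
  moreover have "d \<le> C * (b / a) ^ k" for k
    using le[of k] a by (simp add: field_simps)
  ultimately have "d \<le> C * 0" by (intro LIMSEQ_le_const) auto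
  with d show False by simp
qed

lemma sqrt_eigenvalue_le_operator_norm:
  assumes n: "n > 0" and A: "A \<in> carrier_mat n n"
    and normal: "A * mat_adjoint A = mat_adjoint A * A" and N: "is_vec_norm n N"
    and r: "eigenvalue (mat_adjoint A * A) (complex_of_real r)"
  shows "sqrt r \<le> operator_norm n N A"
proof -
  obtain x where x: "x \<in> carrier_vec n" "x \<noteq> 0\<^sub>v n"
    and eig: "(mat_adjoint A * A) *\<^sub>v x = complex_of_real r \<cdot>\<^sub>v x"
    using r mat_adjoint_carrier[OF A] unfolding eigenvalue_def eigenvector_def by auto
  obtain c where c: "0 < c" "\<And>v. v \<in> carrier_vec n \<Longrightarrow> c * euclidean_length v \<le> N v"
    using euclidean_length_le_vec_norm[OF n N] by blast
  let ?y = "\<lambda>k. ((*\<^sub>v) A ^^ k) x"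
  have y: "?y k \<in> carrier_vec n" for k using A x(1) by (induction k) auto
  note op_nonneg = operator_norm_nonneg[OF n A N]
  have upper: "N (?y k) \<le> N x * operator_norm n N A ^ k" for k
  proof (induction k)
    case (Suc k)
    have "N (?y (Suc k)) \<le> operator_norm n N A * N (?y k)"
      using vec_norm_mult_le_operator_norm[OF n A N y[of k]] by simp
    also have "\<dots> \<le> operator_norm n N A * (N x * operator_norm n N A ^ k)"
      by (rule mult_left_mono[OF Suc.IH op_nonneg])
    finally show ?case by (simp add: mult_ac)
  qed simp
  show ?thesis
  proof (rule le_if_powers_le[OF op_nonneg])
    show "0 < c * euclidean_length x" using c(1) euclidean_length_pos[OF x] by simp
    show "c * euclidean_length x * sqrt r ^ k \<le> N x * operator_norm n N A ^ k" for k
      using c(2)[OF y[of k]] upper[of k] length_power_mult_eigenvector[OF A normal x(1) eig, of k]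
      by (simp add: mult_ac)
  qed
qed

theorem lemma1:
  fixes n :: nat and A :: "complex mat" and N :: "complex vec \<Rightarrow> real"
  assumes "n > 0"
    and "A \<in> carrier_mat n n"
    and "A * mat_adjoint A = mat_adjoint A * A"
    and "is_vec_norm n N"
  shows "euclidean_norm A \<le> operator_norm n N A"
proof -
  let ?B = "mat_adjoint A * A"
  let ?E = "{r. eigenvalue ?B (complex_of_real r)}"
  have B: "?B \<in> carrier_mat n n" using mat_adjoint_carrier[OF assms(2)] assms(2) by simp
  have "complex_of_real ` ?E \<subseteq> spectrum ?B" by (auto simp: spectrum_def)
  then have "finite ?E"
    by (intro finite_imageD[OF finite_subset[OF _ card_finite_spectrum(1)[OF B]]] inj_onI) auto
  moreover obtain c where "eigenvalue ?B c"
    using spectrum_non_empty[OF B] assms(1) by (auto simp: spectrum_def)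
  then have "Re c \<in> ?E" using eigenvalue_adjoint_mult_real[OF assms(2)] by force
  (* Max of an infinite or empty set would be an unspecified number. *)
  ultimately have "Max ?E \<in> ?E" by (intro Max_in) auto
  then show ?thesis
    unfolding euclidean_norm_def
    using sqrt_eigenvalue_le_operator_norm[OF assms] by blast
qed

end
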